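(* Let $\Lambda$ be a lattice and let $\mathfrak{A}$ be a finite set of rational hyperplanes of $\mathcal{P}os(\Lambda)$. Let $\mathcal{F}$ be an $\mathfrak{A}$-facet and let $X\in\mathcal{F}$. Then: (a) $\mathcal{F}=\bigcap_{\mathcal{H}\in\mathfrak{A}}\mathcal{D}_{\mathcal{H}}(X)$. (b) $\overline{\mathcal{F}}=\bigcap_{\mathcal{H}\in\mathfrak{A}}\overline{\mathcal{D}_{\mathcal{H}}(X)}$. (c) $\overline{\mathcal{F}}$ is the union of $\mathcal{F}$ and of facets of dimension strictly smaller than $\dim\mathcal{F}$. (d) If $\mathcal{F}'$ is an $\mathfrak{A}$-facet such that $\overline{\mathcal{F}}=\overline{\mathcal{F}'}$, then $\mathcal{F}=\mathcal{F}'$. Here bars denote closures in $\mathcal{P}os(\Lambda)$ and empty intersections are equal to $\mathcal{P}os(\Lambda)$.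
   Context: A lattice is a free abelian group of finite rank; $V=\mathbb{R}\otimes_{\mathbb{Z}}\Lambda$ and $V^*$ is its real dual. A subset $X\subseteq\Lambda$ is called positive if $\Lambda=X\cup(-X)$, $X+X\subseteq X$, and $X\cap(-X)$ is a subgroup of $\Lambda$. $\mathcal{P}os(\Lambda)$ is the set of positive subsets of $\Lambda$. For $E\subseteq\Lambda$ put $\mathcal{U}(E)=\{X\in\mathcal{P}os(\Lambda)\mid X\cap E=\varnothing\}$ and $\mathcal{U}(\lambda)=\mathcal{U}(\{\lambda\})$. $\mathcal{P}os(\Lambda)$ has the topology in which $\mathcal{U}$ is open iff for every $X\in\mathcal{U}$ there is a finite $E\subseteq\Lambda$ with $X\in\mathcal{U}(E)\subseteq\mathcal{U}$. For $\varphi\in V^*$, $\mathrm{Pos}(\varphi)=\{\lambda\in\Lambda\mid\varphi(\lambda)\ge0\}\in\mathcal{P}os(\Lambda)$; this defines a map $\mathrm{Pos}:V^*\to\mathcal{P}os(\Lambda)$. A rational hyperplane of $\mathcal{P}os(\Lambda)$ is a subset of the form $\mathcal{H}_\lambda=\{X\in\mathcal{P}os(\Lambda)\mid\lambda\in X\cap(-X)\}$ with $\lambda\in\Lambda\setminus\{0\}$. One has the disjoint union $\mathcal{P}os(\Lambda)=\mathcal{U}(\lambda)\sqcup\mathcal{H}_\lambda\sqcup\mathcal{U}(-\lambda)$. For $\mathcal{H}=\mathcal{H}_\lambda$, let $\smile_{\mathcal{H}}$ be the equivalence relation on $\mathcal{P}os(\Lambda)$ with classes $\mathcal{U}(\lambda)$,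 $\mathcal{H}$, $\mathcal{U}(-\lambda)$ (independent of the choice of $\lambda$), and let $\mathcal{D}_{\mathcal{H}}(X)$ be the class of $X$. Write $X\smile_{\mathfrak{A}}Y$ if $X\smile_{\mathcal{H}}Y$ for all $\mathcal{H}\in\mathfrak{A}$; the ($\mathfrak{A}$-)facets are the equivalence classes of $\smile_{\mathfrak{A}}$. For a facet $\mathcal{F}$, its support is $\mathcal{L}_{\mathfrak{A}}(\mathcal{F})=\bigcap_{\mathcal{H}\in\mathfrak{A},\,\mathcal{F}\subseteq\mathcal{H}}\mathcal{H}$ (equal to $\mathcal{P}os(\Lambda)$ if no $\mathcal{H}\in\mathfrak{A}$ contains $\mathcal{F}$), and $\dim\mathcal{F}=\dim_{\mathbb{R}}\mathrm{Pos}^{-1}(\mathcal{L}_{\mathfrak{A}}(\mathcal{F}))$, where $\mathrm{Pos}^{-1}(\mathcal{L}_{\mathfrak{A}}(\mathcal{F}))$ is a linear subspace of $V^*$. *)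

theory Defs
  imports "HOL-Analysis.Analysis" "HOL-Library.Poly_Mapping"
begin

text \<open>Abelian groups are types of class \<open>ab_group_add\<close>, regarded as modules over the integers.\<close>

definition zscale :: "int \<Rightarrow> 'a::ab_group_add \<Rightarrow> 'a" where
  "zscale k x = (\<Sum>i<nat k. x) - (\<Sum>i<nat (- k). x)"

lemma zscale_diff: "zscale (int m - int n) x = (\<Sum>i<m. x) - (\<Sum>i<n. x)"
proof -
  have split: "(\<Sum>i<a + b. x) = (\<Sum>i<a. x) + (\<Sum>i<b. x)" for a b :: nat
    by (induction b) (simp_all add: add.assoc)
  show ?thesis
  proof (cases "n \<le> m")
    case True
    then obtain d where "m = n + d" using le_Suc_ex by blast
    then show ?thesis by (simp add: zscale_def split)
  next
    case False
    then obtain d where "n = m + d" using le_Suc_ex nat_le_linear by blast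
    then show ?thesis by (simp add: zscale_def split)
  qed
qed

lemma zscale_add_left: "zscale (k + l) x = zscale k x + zscale l x"
proof -
  have split: "(\<Sum>i<a + b. x) = (\<Sum>i<a. x) + (\<Sum>i<b. x)" for a b :: nat
    by (induction b) (simp_all add: add.assoc)
  obtain a b c d where k: "k = int a - int b" and l: "l = int c - int d"
    by (meson int_diff_cases)
  have "k + l = int (a + c) - int (b + d)"
    by (simp add: k l)
  then have "zscale (k + l) x = (\<Sum>i<a + c. x) - (\<Sum>i<b + d. x)"
    by (simp only: zscale_diff)
  then show ?thesis
    by (simp only: k l zscale_diff split add_diff_add)
qed

lemma zscale_add_right: "zscale k (x + y) = zscale k x + zscale k y"
  by (simp add: zscale_def sum.distrib)

lemma zscale_zero [simp]: "zscale 0 x = 0"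
  by (simp add: zscale_def)

lemma zscale_one [simp]: "zscale 1 x = x"
  by (simp add: zscale_def)

lemma zscale_minus_left: "zscale (- k) x = - zscale k x"
  by (simp add: zscale_def)

lemma zscale_mult: "zscale k (zscale l x) = zscale (k * l) x"
proof -
  have nat: "zscale (int n) (zscale l x) = zscale (int n * l) x" for n
  proof (induction n)
    case (Suc n)
    have "int (Suc n) * l = int n * l + l" by (simp add: algebra_simps)
    then show ?case using Suc zscale_add_left[of "int n" 1]
      by (simp add: zscale_add_left add.commute)
  qed simp
  show ?thesis
  proof (cases "0 \<le> k")
    case True
    then show ?thesis using nat[of "nat k"] by simp
  next
    case False
    then show ?thesis using nat[of "nat (- k)"] by (simp add: zscale_minus_left)
  qed
qed

interpretation zmod: module "zscale :: int \<Rightarrow> 'a \<Rightarrow> 'a::ab_group_add"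
  by standard (simp_all add: zscale_add_left zscale_add_right zscale_mult)

text \<open>A lattice is a free abelian group of finite rank, i.e. one that has a finite
  \<open>\<int>\<close>-basis (the empty one for the trivial group).\<close>

definition is_lattice :: "'a::ab_group_add itself \<Rightarrow> bool" where
  "is_lattice _ \<longleftrightarrow>
     (\<exists>B :: 'a set. finite B \<and> \<not> zmod.dependent B \<and> zmod.span B = UNIV)"


section \<open>Extension of scalars and the dual\<close>

text \<open>The tensor product of \<open>\<real>\<close> and \<open>'a\<close> over the integers: the free abelian group on the
  pairs \<open>(r, a)\<close> modulo the subgroup generated by the bilinearity relations (these
  imply that integers may be moved across).\<close>

inductive_set tensor_relations :: "((real \<times> 'a::ab_group_add) \<Rightarrow>\<^sub>0 int) set" where
  zero: "0 \<in> tensor_relations"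
| left: "frag_of (r + s, a) - frag_of (r, a) - frag_of (s, a) \<in> tensor_relations"
| right: "frag_of (r, a + b) - frag_of (r, a) - frag_of (r, b) \<in> tensor_relations"
| diff: "\<lbrakk>u \<in> tensor_relations; v \<in> tensor_relations\<rbrakk> \<Longrightarrow> u - v \<in> tensor_relations"

lemma tensor_relations_minus: "u \<in> tensor_relations \<Longrightarrow> - u \<in> tensor_relations"
  using tensor_relations.diff[OF tensor_relations.zero] by simp

lemma tensor_relations_add:
  "\<lbrakk>u \<in> tensor_relations; v \<in> tensor_relations\<rbrakk> \<Longrightarrow> u + v \<in> tensor_relations"
  using tensor_relations.diff[OF _ tensor_relations_minus] by fastforce

definition tensor_scale ::
    "real \<Rightarrow> ((real \<times> 'a::ab_group_add) \<Rightarrow>\<^sub>0 int) \<Rightarrow> ((real \<times> 'a) \<Rightarrow>\<^sub>0 int)" where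
  "tensor_scale t = frag_extend (\<lambda>(r, a). frag_of (t * r, a))"

lemma tensor_scale_of [simp]: "tensor_scale t (frag_of (r, a)) = frag_of (t * r, a)"
  by (simp add: tensor_scale_def)

lemma tensor_scale_add: "tensor_scale t (u + v) = tensor_scale t u + tensor_scale t v"
  by (simp add: tensor_scale_def frag_extend_add)

lemma tensor_scale_diff: "tensor_scale t (u - v) = tensor_scale t u - tensor_scale t v"
  by (simp add: tensor_scale_def frag_extend_diff)

lemma tensor_scale_zero [simp]: "tensor_scale t 0 = 0"
  by (simp add: tensor_scale_def)

lemma tensor_scale_relations: "u \<in> tensor_relations \<Longrightarrow> tensor_scale t u \<in> tensor_relations"
  by (induction rule: tensor_relations.induct)
     (simp_all add: tensor_scale_diff distrib_left tensor_relations.intros)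

lemma frag_of_induct:
  assumes "P 0" and "\<And>x. P (frag_of x)" and "\<And>u v. P u \<Longrightarrow> P v \<Longrightarrow> P (u - v)"
  shows "P (u :: 'b \<Rightarrow>\<^sub>0 int)"
  using frag_induction[of u UNIV P] assms by auto

quotient_type (overloaded) 'a realification =
    "((real \<times> 'a::ab_group_add) \<Rightarrow>\<^sub>0 int)" / "\<lambda>u v. u - v \<in> tensor_relations"
proof (rule equivpI)
  show "reflp (\<lambda>u v :: ((real \<times> 'a) \<Rightarrow>\<^sub>0 int). u - v \<in> tensor_relations)"
    by (simp add: reflp_def tensor_relations.zero)
  show "symp (\<lambda>u v :: ((real \<times> 'a) \<Rightarrow>\<^sub>0 int). u - v \<in> tensor_relations)"
    using tensor_relations_minus by (fastforce simp: symp_def)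
  show "transp (\<lambda>u v :: ((real \<times> 'a) \<Rightarrow>\<^sub>0 int). u - v \<in> tensor_relations)"
    using tensor_relations_add by (fastforce simp: transp_def)
qed

instantiation realification :: (ab_group_add) real_vector
begin

lift_definition zero_realification :: "'a realification" is 0 .

lift_definition plus_realification ::
  "'a realification \<Rightarrow> 'a realification \<Rightarrow> 'a realification" is "(+)"
proof -
  fix u u' v v' :: "(real \<times> 'a) \<Rightarrow>\<^sub>0 int"
  assume "u - u' \<in> tensor_relations" "v - v' \<in> tensor_relations"
  then have "(u - u') + (v - v') \<in> tensor_relations" by (rule tensor_relations_add)
  then show "u + v - (u' + v') \<in> tensor_relations" by (simp only: add_diff_add)
qed

lift_definition uminus_realification :: "'a realification \<Rightarrow> 'a realification" is uminus
proof -
  fix u u' :: "(real \<times> 'a) \<Rightarrow>\<^sub>0 int"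
  assume "u - u' \<in> tensor_relations"
  then have "- (u - u') \<in> tensor_relations" by (rule tensor_relations_minus)
  then show "- u - - u' \<in> tensor_relations" by simp
qed

lift_definition minus_realification ::
  "'a realification \<Rightarrow> 'a realification \<Rightarrow> 'a realification" is "(-)"
proof -
  fix u u' v v' :: "(real \<times> 'a) \<Rightarrow>\<^sub>0 int"
  assume "u - u' \<in> tensor_relations" "v - v' \<in> tensor_relations"
  then have "(u - u') - (v - v') \<in> tensor_relations" by (rule tensor_relations.diff)
  then show "u - v - (u' - v') \<in> tensor_relations" by (simp add: algebra_simps)
qed

lift_definition scaleR_realification :: "real \<Rightarrow> 'a realification \<Rightarrow> 'a realification"
  is tensor_scale
  by (simp add: tensor_scale_relations flip: tensor_scale_diff)

instance
proof
  fix r s :: real and x y z :: "'a realification"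
  show "x + y + z = x + (y + z)"
    by transfer (simp add: add.assoc tensor_relations.zero)
  show "x + y = y + x"
    by transfer (simp add: add.commute tensor_relations.zero)
  show "0 + x = x"
    by transfer (simp add: tensor_relations.zero)
  show "- x + x = 0"
    by transfer (simp add: tensor_relations.zero)
  show "x - y = x + - y"
    by transfer (simp add: tensor_relations.zero)
  show "r *\<^sub>R (x + y) = r *\<^sub>R x + r *\<^sub>R y"
    by transfer (simp add: tensor_scale_add tensor_relations.zero)
  show "(r + s) *\<^sub>R x = r *\<^sub>R x + s *\<^sub>R x"
  proof transfer
    fix r s :: real and u :: "(real \<times> 'a) \<Rightarrow>\<^sub>0 int"
    show "tensor_scale (r + s) u - (tensor_scale r u + tensor_scale s u) \<in> tensor_relations"
    proof (induction u rule: frag_of_induct)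
      case (2 x)
      then show ?case
        by (cases x) (simp add: distrib_right diff_diff_add[symmetric] tensor_relations.left)
    next
      case (3 u v)
      then show ?case
        using tensor_relations.diff[OF 3]
        by (simp add: tensor_scale_diff algebra_simps)
    qed (simp add: tensor_relations.zero)
  qed
  show "r *\<^sub>R s *\<^sub>R x = (r * s) *\<^sub>R x"
  proof transfer
    fix r s :: real and u :: "(real \<times> 'a) \<Rightarrow>\<^sub>0 int"
    have "tensor_scale r (tensor_scale s u) = tensor_scale (r * s) u"
    proof (induction u rule: frag_of_induct)
      case (2 x)
      then show ?case by (cases x) (simp add: mult.assoc)
    qed (simp_all add: tensor_scale_diff)
    then show "tensor_scale r (tensor_scale s u) - tensor_scale (r * s) u \<in> tensor_relations"
      by (simp add: tensor_relations.zero)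
  qed
  show "1 *\<^sub>R x = x"
  proof transfer
    fix u :: "(real \<times> 'a) \<Rightarrow>\<^sub>0 int"
    have "tensor_scale 1 u = u"
    proof (induction u rule: frag_of_induct)
      case (2 x)
      then show ?case by (cases x) simp
    qed (simp_all add: tensor_scale_diff)
    then show "tensor_scale 1 u - u \<in> tensor_relations"
      by (simp add: tensor_relations.zero)
  qed
qed

end

lift_definition tensor :: "real \<Rightarrow> 'a::ab_group_add \<Rightarrow> 'a realification" (infixr "\<otimes>\<^sub>\<real>" 75)
  is "\<lambda>r a. frag_of (r, a)" .

lemma tensor_add_left: "(r + s) \<otimes>\<^sub>\<real> a = r \<otimes>\<^sub>\<real> a + s \<otimes>\<^sub>\<real> a"
  by transfer (simp add: diff_diff_add[symmetric] tensor_relations.left)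

lemma tensor_add_right: "r \<otimes>\<^sub>\<real> (a + b) = r \<otimes>\<^sub>\<real> a + r \<otimes>\<^sub>\<real> b"
  by transfer (simp add: diff_diff_add[symmetric] tensor_relations.right)

lemma scaleR_tensor: "t *\<^sub>R (r \<otimes>\<^sub>\<real> a) = (t * r) \<otimes>\<^sub>\<real> a"
  by transfer (simp add: tensor_relations.zero)

lemma tensor_zero_right [simp]: "r \<otimes>\<^sub>\<real> 0 = 0"
  using tensor_add_right[of r 0 0] by simp

lemma tensor_minus_right: "r \<otimes>\<^sub>\<real> (- a) = - (r \<otimes>\<^sub>\<real> a)"
  using tensor_add_right[of r a "- a"] by (simp add: eq_neg_iff_add_eq_0 add.commute)

text \<open>The algebraic dual, made into a type so that the library's \<open>dim\<close> applies to it.\<close>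

typedef (overloaded) 'v dual = "{f :: 'v::real_vector \<Rightarrow> real. linear f}"
  morphisms dual_apply Abs_dual
  by (rule exI[of _ "\<lambda>_. 0"]) (simp add: linear_iff)

setup_lifting type_definition_dual

instantiation dual :: (real_vector) real_vector
begin

lift_definition zero_dual :: "'a dual" is "\<lambda>_. 0"
  by (simp add: linear_iff)

lift_definition plus_dual :: "'a dual \<Rightarrow> 'a dual \<Rightarrow> 'a dual" is "\<lambda>f g x. f x + g x"
  by (simp add: linear_compose_add)

lift_definition uminus_dual :: "'a dual \<Rightarrow> 'a dual" is "\<lambda>f x. - f x"
  by (simp add: linear_compose_neg)

lift_definition minus_dual :: "'a dual \<Rightarrow> 'a dual \<Rightarrow> 'a dual" is "\<lambda>f g x. f x - g x"
  by (simp add: linear_compose_sub)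

lift_definition scaleR_dual :: "real \<Rightarrow> 'a dual \<Rightarrow> 'a dual" is "\<lambda>r f x. r * f x"
  by (simp add: linear_iff algebra_simps)

instance
  by standard (transfer; simp add: fun_eq_iff algebra_simps)+

end


section \<open>Positive subsets\<close>

definition positive :: "'a::ab_group_add set \<Rightarrow> bool" where
  "positive X \<longleftrightarrow>
     UNIV = X \<union> uminus ` X \<and>
     (\<forall>x\<in>X. \<forall>y\<in>X. x + y \<in> X) \<and>
     (let H = X \<inter> uminus ` X
      in 0 \<in> H \<and> (\<forall>x\<in>H. \<forall>y\<in>H. x + y \<in> H) \<and> (\<forall>x\<in>H. - x \<in> H))"

definition Pos_sets :: "'a::ab_group_add set set" where
  "Pos_sets = {X. positive X}"

definition avoiding :: "'a::ab_group_add set \<Rightarrow> 'a set set" where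
  "avoiding E = {X \<in> Pos_sets. X \<inter> E = {}}"

definition Pos_topology :: "'a::ab_group_add set topology" where
  "Pos_topology = topology (\<lambda>U. U \<subseteq> Pos_sets \<and>
     (\<forall>X\<in>U. \<exists>E. finite E \<and> X \<in> avoiding E \<and> avoiding E \<subseteq> U))"

lemma openin_Pos_topology:
  fixes U :: "'a::ab_group_add set set"
  shows "openin Pos_topology U \<longleftrightarrow>
     U \<subseteq> Pos_sets \<and> (\<forall>X\<in>U. \<exists>E. finite E \<and> X \<in> avoiding E \<and> avoiding E \<subseteq> U)"
proof -
  let ?O = "\<lambda>U :: 'a set set. U \<subseteq> Pos_sets \<and>
    (\<forall>X\<in>U. \<exists>E. finite E \<and> X \<in> avoiding E \<and> avoiding E \<subseteq> U)"
  have int: "?O (S \<inter> T)" if S: "?O S" and T: "?O T" for S T :: "'a set set"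
  proof (intro conjI ballI)
    show "S \<inter> T \<subseteq> Pos_sets" using S by blast
    fix X assume "X \<in> S \<inter> T"
    with S T obtain E E' where "finite E" "X \<in> avoiding E" "avoiding E \<subseteq> S"
      "finite E'" "X \<in> avoiding E'" "avoiding E' \<subseteq> T" by (meson IntD1 IntD2)
    then show "\<exists>E. finite E \<and> X \<in> avoiding E \<and> avoiding E \<subseteq> S \<inter> T"
      by (intro exI[of _ "E \<union> E'"]) (auto simp: avoiding_def)
  qed
  have un: "?O (\<Union>K)" if K: "\<forall>U\<in>K. ?O U" for K :: "'a set set set"
  proof (intro conjI ballI)
    show "\<Union>K \<subseteq> Pos_sets" using K by blast
    fix X assume "X \<in> \<Union>K"
    with K show "\<exists>E. finite E \<and> X \<in> avoiding E \<and> avoiding E \<subseteq> \<Union>K"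
      by (meson Union_iff Sup_upper subset_trans)
  qed
  have "istopology ?O"
    unfolding istopology_def
  proof (rule conjI)
    show "\<forall>S T. ?O S \<longrightarrow> ?O T \<longrightarrow> ?O (S \<inter> T)"
      by (intro allI impI) (erule (1) int)
    show "\<forall>K. (\<forall>U\<in>K. ?O U) \<longrightarrow> ?O (\<Union>K)"
      by (intro allI impI) (erule un)
  qed
  then show ?thesis
    unfolding Pos_topology_def by (rule topology_inverse'[THEN fun_cong])
qed

lemma topspace_Pos_topology: "topspace Pos_topology = Pos_sets"
proof -
  have "openin Pos_topology (Pos_sets :: 'a set set)"
    unfolding openin_Pos_topology
    by (auto intro!: exI[of _ "{}"] simp: avoiding_def)
  then show ?thesis
    using openin_subset openin_topspace[of Pos_topology, unfolded openin_Pos_topology] by blast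
qed

definition Pos :: "'a::ab_group_add realification dual \<Rightarrow> 'a set" where
  "Pos \<phi> = {l. dual_apply \<phi> (1 \<otimes>\<^sub>\<real> l) \<ge> 0}"

lemma Pos_in_Pos_sets: "Pos \<phi> \<in> Pos_sets"
proof -
  have lin: "linear (dual_apply \<phi>)" using dual_apply[of \<phi>] by simp
  have m: "l \<in> uminus ` X \<longleftrightarrow> - l \<in> X" for l :: 'a and X
    by (metis (no_types, lifting) imageE image_eqI minus_minus)
  show ?thesis
    by (auto simp: Pos_sets_def positive_def Pos_def Let_def m tensor_add_right
        tensor_minus_right linear_add[OF lin] linear_neg[OF lin] linear_0[OF lin])
qed


section \<open>Rational hyperplanes and facets\<close>

definition hyperplane_of :: "'a::ab_group_add \<Rightarrow> 'a set set" where
  "hyperplane_of l = {X \<in> Pos_sets. l \<in> X \<inter> uminus ` X}"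

definition rational_hyperplanes :: "'a::ab_group_add set set set" where
  "rational_hyperplanes = {hyperplane_of l | l. l \<noteq> 0}"

text \<open>The equivalence relation on \<^term>\<open>Pos_sets\<close> attached to a rational hyperplane \<open>H\<close>, as
  a set of pairs. It is given by an arbitrary choice of \<open>l \<noteq> 0\<close> with
  \<^term>\<open>H = hyperplane_of l\<close>, on which it does not depend when \<open>'a\<close> is a lattice.\<close>

definition side_rel :: "'a::ab_group_add set set \<Rightarrow> ('a set \<times> 'a set) set" where
  "side_rel H =
     (let l = SOME l. l \<noteq> 0 \<and> H = hyperplane_of l
      in \<Union>C\<in>{avoiding {l}, H, avoiding {- l}}. C \<times> C)"

definition side :: "'a::ab_group_add set set \<Rightarrow> 'a set \<Rightarrow> 'a set set" where
  "side H X = side_rel H `` {X}"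

definition facet_rel :: "'a::ab_group_add set set set \<Rightarrow> ('a set \<times> 'a set) set" where
  "facet_rel A = {(X, Y). X \<in> Pos_sets \<and> Y \<in> Pos_sets \<and> (\<forall>H\<in>A. (X, Y) \<in> side_rel H)}"

definition facets :: "'a::ab_group_add set set set \<Rightarrow> 'a set set set" where
  "facets A = Pos_sets // facet_rel A"

text \<open>The intersection with \<^term>\<open>Pos_sets\<close> makes empty intersections equal to it.\<close>

definition facet_support ::
    "'a::ab_group_add set set set \<Rightarrow> 'a set set \<Rightarrow> 'a set set" where
  "facet_support A F = Pos_sets \<inter> \<Inter>{H \<in> A. F \<subseteq> H}"

definition facet_dim :: "'a::ab_group_add set set set \<Rightarrow> 'a set set \<Rightarrow> nat" where
  "facet_dim A F = dim (Pos -` facet_support A F)"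

end

theory Submission
  imports Defs
begin

text \<open>
  Let \<open>N\<close> be a set of vectors that with every \<open>l\<close> contains \<open>- l\<close>, such as the set of all
  \<open>\<plusminus>l\<close> with \<open>hyperplane_of l \<in> A\<close>. As a positive set contains \<open>l\<close> or \<open>- l\<close>, two positive sets
  lie in the same facet iff they have the same trace on \<open>N\<close>, and the facet of \<open>X\<close> is the set
  of all \<open>Y\<close> with \<open>Y \<inter> N = X \<inter> N\<close>. Its closure is the set of all \<open>Y\<close> with \<open>X \<inter> N \<subseteq> Y\<close>:
  for such a \<open>Y\<close>, the lexicographic refinement of the preorder of \<open>Y\<close> by that of \<open>X\<close> lies in
  the facet of \<open>X\<close> and is contained in \<open>Y\<close>, hence lies in every neighbourhood of \<open>Y\<close>. This
  description gives (a), (b), (d), and that the closure is a union of facets.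

  For a facet \<open>G \<noteq> F\<close> in the closure of \<open>F\<close>, some \<open>n \<in> N\<close> lies in the lineality subgroup
  \<open>Y \<inter> - Y\<close> of \<open>Y \<in> G\<close> but not in that of \<open>X \<in> F\<close>. The quotient by the latter is totally ordered, hence
  torsion-free, so that a homomorphism to the reals kills \<open>X \<inter> - X\<close> but not \<open>n\<close>. It
  separates the two linear subspaces whose dimensions have to be compared.
\<close>

section \<open>Extension of homomorphisms to the reals\<close>

lemma additive_on_zscale:
  fixes f :: "'a::ab_group_add \<Rightarrow> real"
  assumes "zmod.subspace S" and add: "\<And>x y. x \<in> S \<Longrightarrow> y \<in> S \<Longrightarrow> f (x + y) = f x + f y" and "x \<in> S"
  shows "f (zscale k x) = of_int k * f x"
proof -
  have 0: "f 0 = 0" using add[of 0 0] zmod.subspace_0[OF assms(1)] by simp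
  have nat: "f (zscale (int n) x) = real n * f x" for n
  proof (induction n)
    case (Suc n)
    have "zscale (int (Suc n)) x = zscale (int n) x + x"
      using zscale_add_left[of "int n" 1 x] by (simp add: add.commute)
    then show ?case
      using Suc add[of "zscale (int n) x" x] assms(1,3)
      by (simp add: zmod.subspace_scale algebra_simps)
  qed (simp add: 0)
  show ?thesis
  proof (cases k rule: int_cases2)
    case (nonneg n) then show ?thesis using nat by simp
  next
    case (nonpos n)
    have m: "zscale (int n) x \<in> S" "- zscale (int n) x \<in> S"
      using assms by (simp_all add: zmod.subspace_scale zmod.subspace_neg)
    have "f (- zscale (int n) x) = - f (zscale (int n) x)"
      using add[OF m] 0 by simp
    then show ?thesis using nat nonpos by (simp add: zscale_minus_left)
  qed
qed

text \<open>Elements of the larger group have the form \<open>s + zscale n b\<close> with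
  \<open>s\<close> in \<open>S\<close> and get the value \<open>f s + n * c\<close>. Assumption
  \<open>c\<close> is the compatibility of this rule where multiples of \<open>b\<close> already lie
  in \<open>S\<close>.\<close>

lemma extend_additive_insert:
  fixes f :: "'a::ab_group_add \<Rightarrow> real"
  assumes S: "zmod.subspace S" and add: "\<And>x y. x \<in> S \<Longrightarrow> y \<in> S \<Longrightarrow> f (x + y) = f x + f y"
    and c: "\<And>n. zscale n b \<in> S \<Longrightarrow> f (zscale n b) = of_int n * c"
  obtains g where "\<And>x. x \<in> S \<Longrightarrow> g x = f x" "g b = c"
    "\<And>x y. x \<in> zmod.span (insert b S) \<Longrightarrow> y \<in> zmod.span (insert b S) \<Longrightarrow> g (x + y) = g x + g y"
proof
  define k where "k y = (SOME n. y - zscale n b \<in> S)" for y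
  define g where "g y = f (y - zscale (k y) b) + of_int (k y) * c" for y
  \<comment> \<open>Independence of the chosen coefficient: two admissible ones differ by some
    \<open>d\<close> for which \<open>zscale d b\<close> lies in \<open>S\<close>, so that
    \<open>c\<close> applies.\<close>
  have g: "g y = f (y - zscale n b) + of_int n * c" if y: "y - zscale n b \<in> S" for y n
  proof -
    have ky: "y - zscale (k y) b \<in> S" unfolding k_def using y by (rule someI)
    have d: "(y - zscale n b) - (y - zscale (k y) b) = zscale (k y - n) b"
      by (simp add: zmod.scale_left_diff_distrib)
    have kS: "zscale (k y - n) b \<in> S" using zmod.subspace_diff[OF S y ky] d by simp
    have "f (y - zscale n b) = f (y - zscale (k y) b + zscale (k y - n) b)"
      by (simp add: zmod.scale_left_diff_distrib)
    also have "\<dots> = f (y - zscale (k y) b) + of_int (k y - n) * c"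
      using add[OF ky kS] c[OF kS] by simp
    finally show ?thesis by (simp add: g_def algebra_simps)
  qed
  have span: "zmod.span (insert b S) = {x. \<exists>n. x - zscale n b \<in> S}"
    using S by (simp add: zmod.span_insert flip: zmod.span_eq_iff)
  show "g x = f x" if "x \<in> S" for x using g[of x 0] that by simp
  have "f 0 = 0" using c[of 0] zmod.subspace_0[OF S] by simp
  then show "g b = c" using g[of b 1] zmod.subspace_0[OF S] by simp
  fix x y assume "x \<in> zmod.span (insert b S)" "y \<in> zmod.span (insert b S)"
  then obtain m n where x: "x - zscale m b \<in> S" and y: "y - zscale n b \<in> S"
    unfolding span by blast
  have e: "x + y - zscale (m + n) b = (x - zscale m b) + (y - zscale n b)"
    by (simp add: zscale_add_left algebra_simps)
  have "x + y - zscale (m + n) b \<in> S" unfolding e using zmod.subspace_add[OF S x y] .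
  from g[OF this] show "g (x + y) = g x + g y"
    unfolding g[OF x] g[OF y] e add[OF x y] by (simp add: algebra_simps)
qed

text \<open>The reals are divisible, hence an injective \<open>\<int>\<close>-module; the generators
  in \<open>B\<close> are adjoined one at a time.\<close>

lemma extend_additive:
  fixes f :: "'a::ab_group_add \<Rightarrow> real"
  assumes S: "zmod.subspace S" and add: "\<And>x y. x \<in> S \<Longrightarrow> y \<in> S \<Longrightarrow> f (x + y) = f x + f y"
    and "finite B"
  shows "\<exists>g. (\<forall>x\<in>S. g x = f x) \<and>
    (\<forall>x\<in>zmod.span (B \<union> S). \<forall>y\<in>zmod.span (B \<union> S). g (x + y) = g x + g y)"
  using \<open>finite B\<close>
proof (induction B)
  case empty
  show ?case using S add by (intro exI[of _ f]) (simp flip: zmod.span_eq_iff)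
next
  case (insert b B)
  let ?T = "zmod.span (B \<union> S)"
  have T: "zmod.subspace ?T" by (rule zmod.subspace_span)
  obtain g where g: "\<And>x. x \<in> S \<Longrightarrow> g x = f x"
    and gadd: "\<And>x y. x \<in> ?T \<Longrightarrow> y \<in> ?T \<Longrightarrow> g (x + y) = g x + g y"
    using insert.IH by blast
  \<comment> \<open>Divisibility enters here: if a nonzero multiple \<open>zscale m b\<close> lies
    in \<open>?T\<close>, the value at \<open>b\<close> has to be \<open>g (zscale m b) / m\<close>;
    otherwise only \<open>n = 0\<close> occurs, and every value is admissible.\<close>
  have "\<exists>c. \<forall>n. zscale n b \<in> ?T \<longrightarrow> g (zscale n b) = of_int n * c"
  proof (cases "\<exists>m. m \<noteq> 0 \<and> zscale m b \<in> ?T")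
    case True
    then obtain m where m: "m \<noteq> 0" "zscale m b \<in> ?T" by blast
    have "g (zscale n b) = of_int n * (g (zscale m b) / of_int m)" if n: "zscale n b \<in> ?T" for n
    proof -
      have "of_int m * g (zscale n b) = g (zscale (m * n) b)"
        using additive_on_zscale[OF T gadd n, of m] by (simp add: zscale_mult)
      also have "\<dots> = of_int n * g (zscale m b)"
        using additive_on_zscale[OF T gadd m(2), of n] by (simp add: zscale_mult mult.commute)
      finally show ?thesis using m(1) by (simp add: field_simps)
    qed
    then show ?thesis by blast
  next
    case False
    have "g 0 = 0" using gadd[of 0 0] zmod.span_zero by fastforce
    with False show ?thesis by (metis mult_zero_left of_int_0 zscale_zero)
  qed
  then obtain c where c: "\<And>n. zscale n b \<in> ?T \<Longrightarrow> g (zscale n b) = of_int n * c" by blast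
  obtain h where h: "\<And>x. x \<in> ?T \<Longrightarrow> h x = g x"
    and hadd: "\<And>x y. x \<in> zmod.span (insert b ?T) \<Longrightarrow> y \<in> zmod.span (insert b ?T) \<Longrightarrow> h (x + y) = h x + h y"
    using extend_additive_insert[OF T gadd c] by metis
  have "zmod.span (insert b B \<union> S) \<subseteq> zmod.span (insert b ?T)"
    using zmod.span_superset[of "B \<union> S"] by (intro zmod.span_mono) auto
  moreover have "x \<in> S \<Longrightarrow> x \<in> ?T" for x by (simp add: zmod.span_base)
  ultimately show ?case
    using g h hadd by (intro exI[of _ h]) (simp add: subset_iff)
qed

text \<open>The rule \<open>0\<close> on \<open>H\<close> and \<open>1\<close> at \<open>l\<close>
  is consistent because no nonzero multiple of \<open>l\<close> lies in \<open>H\<close>; it then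
  extends along a finite generating set.\<close>

lemma additive_separation:
  fixes l :: "'a::ab_group_add"
  assumes "is_lattice TYPE('a)" and H: "zmod.subspace H"
    and tf: "\<And>n. zscale n l \<in> H \<Longrightarrow> n = 0"
  obtains f :: "'a \<Rightarrow> real" where "Modules.additive f" "\<And>x. x \<in> H \<Longrightarrow> f x = 0" "f l \<noteq> 0"
proof -
  obtain B :: "'a set" where B: "finite B" "zmod.span B = UNIV"
    using assms(1) by (auto simp: is_lattice_def)
  obtain g :: "'a \<Rightarrow> real" where g: "\<And>x. x \<in> H \<Longrightarrow> g x = 0" "g l = 1"
    "\<And>x y. x \<in> zmod.span (insert l H) \<Longrightarrow> y \<in> zmod.span (insert l H) \<Longrightarrow> g (x + y) = g x + g y"
    using extend_additive_insert[OF H, of "\<lambda>_. 0" l 1] tf by auto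
  obtain f where f: "\<forall>x\<in>zmod.span (insert l H). f x = g x"
    "\<forall>x\<in>zmod.span (B \<union> zmod.span (insert l H)).
       \<forall>y\<in>zmod.span (B \<union> zmod.span (insert l H)). f (x + y) = f x + f y"
    using extend_additive[OF zmod.subspace_span g(3) B(1)] by blast
  have "zmod.span (B \<union> zmod.span (insert l H)) = UNIV"
    using zmod.span_mono[of B "B \<union> zmod.span (insert l H)"] B(2) by auto
  with f(2) have "Modules.additive f" by (simp add: Modules.additive_def)
  moreover have "f x = 0" if "x \<in> H" for x using f(1) g(1) that by (simp add: zmod.span_base)
  moreover have "f l \<noteq> 0" using f(1) g(2) by (simp add: zmod.span_base)
  ultimately show ?thesis by (rule that)
qed

section \<open>The dual of the realification\<close>

text \<open>The homomorphism from the free abelian group to the reals that extends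
  \<open>h\<close>.\<close>

definition frag_eval :: "('b \<Rightarrow> real) \<Rightarrow> ('b \<Rightarrow>\<^sub>0 int) \<Rightarrow> real" where
  "frag_eval h u = (\<Sum>k\<in>Poly_Mapping.keys u. of_int (Poly_Mapping.lookup u k) * h k)"

lemma frag_eval_superset:
  assumes "finite K" "Poly_Mapping.keys u \<subseteq> K"
  shows "frag_eval h u = (\<Sum>k\<in>K. of_int (Poly_Mapping.lookup u k) * h k)"
  unfolding frag_eval_def
  using assms by (intro sum.mono_neutral_left) (auto simp: in_keys_iff)

lemma frag_eval_diff: "frag_eval h (u - v) = frag_eval h u - frag_eval h v"
proof -
  let ?K = "Poly_Mapping.keys u \<union> Poly_Mapping.keys v"
  have "Poly_Mapping.keys (u - v) \<subseteq> ?K" by (rule keys_diff)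
  then show ?thesis
    by (simp add: frag_eval_superset[of ?K] lookup_minus sum_subtractf left_diff_distrib)
qed

lemma frag_eval_zero [simp]: "frag_eval h 0 = 0"
  by (simp add: frag_eval_def)

lemma frag_eval_of [simp]: "frag_eval h (frag_of x) = h x"
  by (simp add: frag_eval_def)

lemma frag_eval_add: "frag_eval h (u + v) = frag_eval h u + frag_eval h v"
  using frag_eval_diff[of h "u + v" v] by simp

lemma frag_eval_relations:
  assumes "Modules.additive f" "u \<in> tensor_relations"
  shows "frag_eval (\<lambda>(r, a). r * f a) u = 0"
  using assms(2)
  by (induction) (simp_all add: frag_eval_diff Modules.additive.add[OF assms(1)] distrib_left distrib_right)

text \<open>Universal property of the tensor product: \<open>f\<close> induces the linear functional
  with value \<open>r * f a\<close> at \<open>r \<otimes>\<^sub>\<real> a\<close>.\<close>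

lemma dual_extension:
  fixes f :: "'a::ab_group_add \<Rightarrow> real"
  assumes f: "Modules.additive f"
  obtains \<phi> :: "'a realification dual" where "\<And>l. dual_apply \<phi> (1 \<otimes>\<^sub>\<real> l) = f l"
proof -
  let ?e = "frag_eval (\<lambda>(r, a). r * f a)"
  \<comment> \<open>Defined through a chosen representative; the fact \<open>F\<close> shows that
    any other gives the same value, as \<open>?e\<close> kills the relations.\<close>
  define F where "F v = ?e (rep_realification v)" for v
  have F: "F (abs_realification u) = ?e u" for u
  proof -
    have "rep_realification (abs_realification u) - u \<in> tensor_relations"
      using rep_abs_rsp_left[OF Quotient3_realification, of u u] by (simp add: tensor_relations.zero)
    from frag_eval_relations[OF f this] show ?thesis by (simp add: F_def frag_eval_diff)
  qed
  have scale: "?e (tensor_scale t u) = t * ?e u" for t u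
  proof (induction u rule: frag_of_induct)
    case (2 x) then show ?case by (cases x) simp
  qed (simp_all add: tensor_scale_diff frag_eval_diff algebra_simps)
  have ex: "\<exists>u. v = abs_realification u" for v :: "'a realification"
    using Quotient3_abs_rep[OF Quotient3_realification, of v] by metis
  have "linear F"
  proof (rule linearI)
    fix v w :: "'a realification" and t :: real
    obtain x y where "v = abs_realification x" "w = abs_realification y" using ex by metis
    then show "F (v + w) = F v + F w" "F (t *\<^sub>R v) = t *\<^sub>R F v"
      by (simp_all add: plus_realification.abs_eq scaleR_realification.abs_eq F frag_eval_add scale)
  qed
  then have "dual_apply (Abs_dual F) (1 \<otimes>\<^sub>\<real> l) = f l" for l
    by (simp add: Abs_dual_inverse tensor.abs_eq F)
  then show ?thesis by (rule that)
qed

lemma dual_linear: "linear (dual_apply \<phi>)"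
  using dual_apply[of \<phi>] by simp

lemma dual_additive: "Modules.additive (\<lambda>l. dual_apply \<phi> (1 \<otimes>\<^sub>\<real> l))"
  by (simp add: Modules.additive_def tensor_add_right linear_add[OF dual_linear])

text \<open>The vectors \<open>1 \<otimes>\<^sub>\<real> l\<close> span the realification, because
  \<open>r \<otimes>\<^sub>\<real> a = r *\<^sub>R (1 \<otimes>\<^sub>\<real> a)\<close>.\<close>

lemma dual_eqI:
  fixes \<phi> \<psi> :: "'a::ab_group_add realification dual"
  assumes "\<And>l. dual_apply \<phi> (1 \<otimes>\<^sub>\<real> l) = dual_apply \<psi> (1 \<otimes>\<^sub>\<real> l)"
  shows "\<phi> = \<psi>"
proof -
  have "dual_apply \<phi> (abs_realification u) = dual_apply \<psi> (abs_realification u)" for u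
  proof (induction u rule: frag_of_induct)
    case 1
    show ?case
      by (simp add: linear_0[OF dual_linear] flip: zero_realification_def)
  next
    case (2 x)
    obtain r a where x: "x = (r, a)" by (cases x)
    have "abs_realification (frag_of x) = r *\<^sub>R (1 \<otimes>\<^sub>\<real> a)"
      unfolding scaleR_tensor x by (simp add: tensor.abs_eq)
    then show ?case using assms by (simp add: linear_cmul[OF dual_linear])
  next
    case (3 u v)
    then show ?case
      by (simp add: linear_diff[OF dual_linear] flip: minus_realification.abs_eq)
  qed
  then have "dual_apply \<phi> v = dual_apply \<psi> v" for v
    using Quotient3_abs_rep[OF Quotient3_realification, of v] by metis
  then show ?thesis by (simp add: dual_apply_inject[symmetric] fun_eq_iff)
qed

lemma dual_apply_sum: "dual_apply (\<Sum>i\<in>I. \<phi> i) v = (\<Sum>i\<in>I. dual_apply (\<phi> i) v)"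
  by (induction I rule: infinite_finite_induct) (simp_all add: zero_dual.rep_eq plus_dual.rep_eq)

text \<open>The coordinate functionals of a \<open>\<int>\<close>-basis span the dual. Finite
  dimension is what lets a proper inclusion of subspaces lower \<open>dim\<close>.\<close>

lemma dual_finite_dimensional:
  assumes "is_lattice TYPE('a::ab_group_add)"
  obtains W :: "'a::ab_group_add realification dual set" where "finite W" "span W = UNIV"
proof -
  obtain B :: "'a set" where B: "finite B" "\<not> zmod.dependent B" "zmod.span B = UNIV"
    using assms by (auto simp: is_lattice_def)
  let ?c = "\<lambda>b l. real_of_int (zmod.representation B l b)"
  have "\<exists>\<delta>. \<forall>l. dual_apply \<delta> (1 \<otimes>\<^sub>\<real> l) = ?c b l" for b
  proof -
    have "Modules.additive (?c b)"
      using B by (simp add: Modules.additive_def zmod.representation_add)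
    then show ?thesis using dual_extension by blast
  qed
  then obtain \<delta> where \<delta>: "\<And>b l. dual_apply (\<delta> b) (1 \<otimes>\<^sub>\<real> l) = ?c b l" by metis
  have "\<phi> \<in> span (\<delta> ` B)" for \<phi>
  proof -
    let ?f = "\<lambda>l. dual_apply \<phi> (1 \<otimes>\<^sub>\<real> l)"
    have lin: "?f (zscale k x) = of_int k * ?f x" for k x
      using additive_on_zscale[OF zmod.subspace_UNIV, of ?f x k] Modules.additive.add[OF dual_additive]
      by auto
    have "\<phi> = (\<Sum>b\<in>B. ?f b *\<^sub>R \<delta> b)"
    proof (rule dual_eqI)
      fix l
      have "?f l = ?f (\<Sum>b\<in>B. zscale (zmod.representation B l b) b)"
        using zmod.sum_representation_eq[of B l B] B by simp
      also have "\<dots> = (\<Sum>b\<in>B. ?c b l * ?f b)"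
        by (simp add: Modules.additive.sum[OF dual_additive] lin)
      finally show "?f l = dual_apply (\<Sum>b\<in>B. ?f b *\<^sub>R \<delta> b) (1 \<otimes>\<^sub>\<real> l)"
        by (simp add: dual_apply_sum scaleR_dual.rep_eq \<delta> mult.commute)
    qed
    then show ?thesis by (metis (no_types, lifting) imageI span_base span_scale span_sum)
  qed
  then show ?thesis using that[of "\<delta> ` B"] B(1) by blast
qed

text \<open>A basis of \<open>S\<close> is extended to a basis of \<open>T\<close>. It has to grow,
  since its own span stays inside \<open>S\<close>, and \<open>W\<close> keeps the larger one
  finite.\<close>

lemma dim_psubset_finite:
  fixes S T W :: "'v::real_vector set"
  assumes W: "finite W" "T \<subseteq> span W" and S: "subspace S" and ST: "S \<subset> T"
  shows "dim S < dim T"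
proof -
  obtain B where B: "B \<subseteq> S" "independent B" "S \<subseteq> span B" "card B = dim S"
    by (rule basis_exists)
  obtain C where C: "B \<subseteq> C" "C \<subseteq> T" "independent C" "T \<subseteq> span C"
    using maximal_independent_subset_extend[OF subset_trans[OF B(1)] B(2), of T] ST by blast
  have "finite C" using independent_span_bound[OF W(1) C(3)] C(2) W(2) by auto
  moreover have "B \<noteq> C"
    using C(4) span_minimal[OF B(1) S] ST by blast
  ultimately have "card B < card C" using C(1) by (intro psubset_card_mono) auto
  with B(4) basis_card_eq_dim[OF C(2,4,3)] show ?thesis by simp
qed

section \<open>Positive sets\<close>

lemma Pos_sets_iff:
  "X \<in> Pos_sets \<longleftrightarrow> (\<forall>x. x \<in> X \<or> - x \<in> X) \<and> (\<forall>x\<in>X. \<forall>y\<in>X. x + y \<in> X)"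
proof -
  have m: "l \<in> uminus ` X \<longleftrightarrow> - l \<in> X" for l
    by (metis (no_types, lifting) imageE image_eqI minus_minus)
  have "0 \<in> X" if "\<forall>x. x \<in> X \<or> - x \<in> X" using that[rule_format, of 0] by simp
  then show ?thesis
    unfolding Pos_sets_def positive_def Let_def
    by (auto simp: m set_eq_iff)
qed

lemma Pos_sets_total: "X \<in> Pos_sets \<Longrightarrow> x \<in> X \<or> - x \<in> X"
  by (auto simp: Pos_sets_iff)

lemma Pos_sets_add: "X \<in> Pos_sets \<Longrightarrow> x \<in> X \<Longrightarrow> y \<in> X \<Longrightarrow> x + y \<in> X"
  by (auto simp: Pos_sets_iff)

lemma Pos_sets_zero: "X \<in> Pos_sets \<Longrightarrow> 0 \<in> X"
  using Pos_sets_total[of X 0] by simp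

lemma hyperplane_of_iff: "X \<in> hyperplane_of l \<longleftrightarrow> X \<in> Pos_sets \<and> l \<in> X \<and> - l \<in> X"
  unfolding hyperplane_of_def by (auto simp: image_iff) (metis minus_minus)

lemma Pos_iff: "l \<in> Pos \<phi> \<longleftrightarrow> 0 \<le> dual_apply \<phi> (1 \<otimes>\<^sub>\<real> l)"
  by (simp add: Pos_def)

lemma Pos_in_hyperplane_of: "Pos \<phi> \<in> hyperplane_of l \<longleftrightarrow> dual_apply \<phi> (1 \<otimes>\<^sub>\<real> l) = 0"
  by (auto simp: hyperplane_of_iff Pos_in_Pos_sets Pos_iff tensor_minus_right
      linear_neg[OF dual_linear])

text \<open>A positive \<open>X\<close> is the nonnegative cone of a translation-invariant total
  preorder; these are the elements equivalent to \<open>0\<close>.\<close>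

definition lineality :: "'a::ab_group_add set \<Rightarrow> 'a set" where
  "lineality X = {x. x \<in> X \<and> - x \<in> X}"

lemma subspace_lineality:
  assumes "X \<in> Pos_sets" shows "zmod.subspace (lineality X)"
proof (rule zmod.subspaceI)
  show "0 \<in> lineality X" using Pos_sets_zero[OF assms] by (simp add: lineality_def)
  show add: "x + y \<in> lineality X" if "x \<in> lineality X" "y \<in> lineality X" for x y
    using that Pos_sets_add[OF assms, of x y] Pos_sets_add[OF assms, of "- x" "- y"]
    by (simp add: lineality_def)
  fix k x assume x: "x \<in> lineality X"
  have sum: "(\<Sum>i<n. y) \<in> lineality X" if "y \<in> lineality X" for n :: nat and y
    using that \<open>0 \<in> lineality X\<close> by (induction n) (simp_all add: add)
  have "- y \<in> lineality X" if "y \<in> lineality X" for y using that by (auto simp: lineality_def)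
  then have "(\<Sum>i<nat k. x) + - (\<Sum>i<nat (- k). x) \<in> lineality X"
    using sum[OF x] by (intro add) blast+
  then show "zscale k x \<in> lineality X" by (simp add: zscale_def)
qed

lemma lineality_pure:
  assumes X: "X \<in> Pos_sets" and "zscale n l \<in> lineality X" and "n \<noteq> 0"
  shows "l \<in> lineality X"
proof -
  \<comment> \<open>For a positive multiple of an element \<open>m\<close> of \<open>X\<close>,
    write \<open>- m\<close> as \<open>- zscale (k + 1) m + zscale k m\<close>, a sum of two
    elements of \<open>X\<close>.\<close>
  have nat: "m \<in> lineality X" if nm: "zscale (int (Suc k)) m \<in> lineality X" and m: "m \<in> X" for k m
  proof -
    have "zscale (int j) m \<in> X" for j
    proof (induction j)
      case (Suc j)
      have "zscale (int (Suc j)) m = zscale (int j) m + m"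
        using zscale_add_left[of "int j" 1 m] by (simp add: add.commute)
      then show ?case using Pos_sets_add[OF X Suc m] by simp
    qed (simp add: Pos_sets_zero[OF X])
    then have "- zscale (int (Suc k)) m + zscale (int k) m \<in> X"
      using nm by (intro Pos_sets_add[OF X]) (simp_all add: lineality_def)
    moreover have "- m = - zscale (int (Suc k)) m + zscale (int k) m"
      using zscale_add_left[of "int k" 1 m] by (simp add: add.commute)
    ultimately have "- m \<in> X" by simp
    with m show ?thesis by (simp add: lineality_def)
  qed
  have neg: "- x \<in> lineality X \<longleftrightarrow> x \<in> lineality X" for x by (auto simp: lineality_def)
  have n': "zscale n (- l) \<in> lineality X" "zscale (- n) l \<in> lineality X" "zscale (- n) (- l) \<in> lineality X"
    using assms(2) by (simp_all add: zscale_minus_left neg)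
  \<comment> \<open>The lineality subgroup is symmetric, so the signs of \<open>n\<close> and
    \<open>l\<close> may be changed freely; totality then puts \<open>l\<close> or
    \<open>- l\<close> into \<open>X\<close>.\<close>
  obtain k where "n = int (Suc k) \<or> n = - int (Suc k)"
    using assms(3) by (metis int_cases3 gr0_implies_Suc)
  then have "zscale (int (Suc k)) l \<in> lineality X" "zscale (int (Suc k)) (- l) \<in> lineality X"
    using assms(2) n' by (auto simp del: of_nat_Suc)
  then show ?thesis using nat Pos_sets_total[OF X, of l] neg by blast
qed

text \<open>Strictly positive for \<open>Y\<close>, with ties broken by \<open>X\<close>. A sum of
  two elements of \<open>Y\<close> is a tie only if both are ties, and then both lie in
  \<open>X\<close>.\<close>

lemma Pos_sets_lexicographic:
  assumes "X \<in> Pos_sets" "Y \<in> Pos_sets"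
  shows "{z \<in> Y. - z \<in> Y \<longrightarrow> z \<in> X} \<in> Pos_sets"
proof -
  have "x + y \<in> X"
    if xy: "x \<in> Y" "- x \<in> Y \<longrightarrow> x \<in> X" "y \<in> Y" "- y \<in> Y \<longrightarrow> y \<in> X" "- (x + y) \<in> Y" for x y
  proof -
    have "- x = - (x + y) + y" "- y = - (x + y) + x" by simp_all
    then have "- x \<in> Y" "- y \<in> Y" using xy Pos_sets_add[OF assms(2)] by metis+
    then show ?thesis using xy Pos_sets_add[OF assms(1)] by simp
  qed
  then show ?thesis
    using assms by (auto simp: Pos_sets_iff)
qed

section \<open>Facets as trace classes\<close>

definition trace_class :: "'a::ab_group_add set \<Rightarrow> 'a set \<Rightarrow> 'a set set" where
  "trace_class N X = {Y \<in> Pos_sets. Y \<inter> N = X \<inter> N}"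

lemma closure_of_trace_class:
  assumes X: "X \<in> Pos_sets" and N: "\<And>n. n \<in> N \<Longrightarrow> - n \<in> N"
  shows "Pos_topology closure_of trace_class N X = {Y \<in> Pos_sets. X \<inter> N \<subseteq> Y}"
proof (intro set_eqI iffI)
  fix Y assume Y: "Y \<in> Pos_topology closure_of trace_class N X"
  then have YP: "Y \<in> Pos_sets" by (simp add: in_closure_of topspace_Pos_topology)
  \<comment> \<open>Every member of the class contains \<open>n\<close>, so
    \<open>avoiding {n}\<close> would be a neighbourhood of \<open>Y\<close> disjoint from the
    class.\<close>
  have "n \<in> Y" if n: "n \<in> X" "n \<in> N" for n
  proof (rule ccontr)
    assume "n \<notin> Y"
    then have "Y \<in> avoiding {n}" using YP by (simp add: avoiding_def)
    moreover have "openin Pos_topology (avoiding {n})"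
      unfolding openin_Pos_topology by (auto intro!: exI[of _ "{n}"]) (simp add: avoiding_def)
    ultimately obtain Z where "Z \<in> trace_class N X" "Z \<in> avoiding {n}"
      using Y unfolding in_closure_of by blast
    then show False using n by (auto simp: trace_class_def avoiding_def)
  qed
  then show "Y \<in> {Y \<in> Pos_sets. X \<inter> N \<subseteq> Y}" using YP by blast
next
  fix Y assume "Y \<in> {Y \<in> Pos_sets. X \<inter> N \<subseteq> Y}"
  then have Y: "Y \<in> Pos_sets" "X \<inter> N \<subseteq> Y" by auto
  let ?Z = "{z \<in> Y. - z \<in> Y \<longrightarrow> z \<in> X}"
  \<comment> \<open>If \<open>z\<close> were not in \<open>X\<close>, then \<open>- z\<close> would
    lie in \<open>X \<inter> N\<close> and so in \<open>Y\<close>; this makes \<open>z\<close> a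
    tie, which \<open>X\<close> has to contain.\<close>
  have "z \<in> X" if "z \<in> ?Z" "z \<in> N" for z
    using that Pos_sets_total[OF X, of z] N[of z] Y(2) by blast
  then have "?Z \<inter> N = X \<inter> N" using Y(2) by blast
  then have Z: "?Z \<in> trace_class N X"
    using Pos_sets_lexicographic[OF X Y(1)] by (simp add: trace_class_def)
  have "?Z \<in> U" if U: "Y \<in> U" "openin Pos_topology U" for U
  proof -
    obtain E where "Y \<in> avoiding E" "avoiding E \<subseteq> U"
      using U unfolding openin_Pos_topology by meson
    moreover have "?Z \<in> avoiding E" if "Y \<in> avoiding E"
      using that Z by (auto simp: avoiding_def trace_class_def)
    ultimately show ?thesis by blast
  qed
  then show "Y \<in> Pos_topology closure_of trace_class N X"
    using Y(1) Z unfolding in_closure_of topspace_Pos_topology by blast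
qed

text \<open>Repeats the choice made inside \<open>side_rel\<close>, so that it can be folded
  there.\<close>

definition normal :: "'a::ab_group_add set set \<Rightarrow> 'a" where
  "normal H = (SOME l. l \<noteq> 0 \<and> H = hyperplane_of l)"

text \<open>With both signs, the trace on \<open>normals {H}\<close> tells the hyperplane and its
  two sides apart, and the set is symmetric as \<open>closure_of_trace_class\<close>
  requires.\<close>

definition normals :: "'a::ab_group_add set set set \<Rightarrow> 'a set" where
  "normals A = (\<Union>H\<in>A. {normal H, - normal H})"

lemma hyperplane_of_normal:
  assumes "H \<in> rational_hyperplanes" shows "hyperplane_of (normal H) = H"
proof -
  have "\<exists>l. l \<noteq> 0 \<and> H = hyperplane_of l" using assms by (auto simp: rational_hyperplanes_def)
  then have "normal H \<noteq> 0 \<and> H = hyperplane_of (normal H)" unfolding normal_def by (rule someI_ex)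
  then show ?thesis by simp
qed

lemma minus_normals: "n \<in> normals A \<Longrightarrow> - n \<in> normals A"
  by (auto simp: normals_def)

lemma side_rel_iff:
  assumes "H \<in> rational_hyperplanes"
  shows "(X, Y) \<in> side_rel H \<longleftrightarrow> X \<in> Pos_sets \<and> Y \<in> trace_class (normals {H}) X"
proof -
  let ?l = "normal H"
  have "side_rel H = (\<Union>C\<in>{avoiding {?l}, hyperplane_of ?l, avoiding {- ?l}}. C \<times> C)"
    unfolding side_rel_def normal_def[symmetric] Let_def
    by (simp add: hyperplane_of_normal[OF assms])
  then show ?thesis
    using Pos_sets_total[of X ?l] Pos_sets_total[of Y ?l]
    by (auto simp: trace_class_def normals_def avoiding_def hyperplane_of_iff)
qed

lemma side_eq_trace_class:
  assumes "H \<in> rational_hyperplanes" "X \<in> Pos_sets"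
  shows "side H X = trace_class (normals {H}) X"
  using side_rel_iff[OF assms(1)] assms(2) by (auto simp: side_def)

lemma facet_rel_iff:
  assumes "A \<subseteq> rational_hyperplanes"
  shows "(X, Y) \<in> facet_rel A \<longleftrightarrow> X \<in> Pos_sets \<and> Y \<in> trace_class (normals A) X"
proof -
  have "Y \<inter> normals A = X \<inter> normals A \<longleftrightarrow> (\<forall>H\<in>A. Y \<inter> normals {H} = X \<inter> normals {H})"
    unfolding normals_def by blast
  moreover have "(X, Y) \<in> side_rel H \<longleftrightarrow> X \<in> Pos_sets \<and> Y \<in> trace_class (normals {H}) X" if "H \<in> A" for H
    using side_rel_iff assms that by blast
  ultimately show ?thesis
    by (auto simp: facet_rel_def trace_class_def)
qed

lemma facets_eq:
  assumes "A \<subseteq> rational_hyperplanes"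
  shows "facets A = trace_class (normals A) ` Pos_sets"
proof -
  have "facet_rel A `` {X} = trace_class (normals A) X" if "X \<in> Pos_sets" for X
    using facet_rel_iff[OF assms] that by auto
  then show ?thesis by (auto simp: facets_def quotient_def image_iff)
qed

lemma trace_class_eq: "Y \<in> trace_class N X \<Longrightarrow> trace_class N Y = trace_class N X"
  by (auto simp: trace_class_def)

section \<open>Supports and dimensions of facets\<close>

lemma facet_support_preimage:
  assumes A: "A \<subseteq> rational_hyperplanes" and X: "X \<in> Pos_sets"
  shows "Pos -` facet_support A (trace_class (normals A) X) =
    {\<phi>. \<forall>n\<in>normals A \<inter> lineality X. dual_apply \<phi> (1 \<otimes>\<^sub>\<real> n) = 0}"
proof -
  \<comment> \<open>Membership in \<open>H\<close> can be read off from the trace, so a facet lies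
    in \<open>H\<close> as soon as one of its points does.\<close>
  have H: "trace_class (normals A) X \<subseteq> H \<longleftrightarrow> normal H \<in> lineality X" if HA: "H \<in> A" for H
  proof -
    have n: "normal H \<in> normals A" "- normal H \<in> normals A" using HA by (auto simp: normals_def)
    have e: "Y \<in> H \<longleftrightarrow> Y \<in> Pos_sets \<and> normal H \<in> Y \<and> - normal H \<in> Y" for Y
      using hyperplane_of_iff[of Y "normal H"] hyperplane_of_normal[of H] HA A by auto
    have "Y \<in> H" if "Y \<in> trace_class (normals A) X" "normal H \<in> lineality X" for Y
      using that n by (auto simp: e trace_class_def lineality_def)
    moreover have "X \<in> trace_class (normals A) X" using X by (simp add: trace_class_def)
    moreover have "X \<in> H \<longleftrightarrow> normal H \<in> lineality X"
      using X by (simp add: e lineality_def)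
    ultimately show ?thesis by blast
  qed
  have P: "Pos \<phi> \<in> H \<longleftrightarrow> dual_apply \<phi> (1 \<otimes>\<^sub>\<real> normal H) = 0" if "H \<in> A" for H \<phi>
    using Pos_in_hyperplane_of[of \<phi> "normal H"] hyperplane_of_normal[of H] that A by auto
  have "\<phi> \<in> Pos -` facet_support A (trace_class (normals A) X) \<longleftrightarrow>
      (\<forall>H\<in>A. normal H \<in> lineality X \<longrightarrow> dual_apply \<phi> (1 \<otimes>\<^sub>\<real> normal H) = 0)" for \<phi>
    using H P by (auto simp: facet_support_def Pos_in_Pos_sets)
  moreover have "(\<forall>n\<in>normals A \<inter> lineality X. dual_apply \<phi> (1 \<otimes>\<^sub>\<real> n) = 0) \<longleftrightarrow>
      (\<forall>H\<in>A. normal H \<in> lineality X \<longrightarrow> dual_apply \<phi> (1 \<otimes>\<^sub>\<real> normal H) = 0)" for \<phi>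
  proof -
    have "- n \<in> lineality X \<longleftrightarrow> n \<in> lineality X" for n by (auto simp: lineality_def)
    then show ?thesis
      by (auto simp: normals_def tensor_minus_right linear_neg[OF dual_linear])
  qed
  ultimately show ?thesis by (intro set_eqI) simp
qed

lemma facet_dim_less:
  fixes A :: "'a::ab_group_add set set set"
  assumes L: "is_lattice TYPE('a)" and A: "A \<subseteq> rational_hyperplanes"
    and X: "X \<in> Pos_sets" and Y: "Y \<in> Pos_sets" and XY: "X \<inter> normals A \<subset> Y \<inter> normals A"
  shows "facet_dim A (trace_class (normals A) Y) < facet_dim A (trace_class (normals A) X)"
proof -
  let ?V = "\<lambda>X. {\<phi> :: 'a realification dual. \<forall>n\<in>normals A \<inter> lineality X. dual_apply \<phi> (1 \<otimes>\<^sub>\<real> n) = 0}"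
  have sub: "subspace (?V X)" for X
    by (auto simp: subspace_def zero_dual.rep_eq plus_dual.rep_eq scaleR_dual.rep_eq)
  \<comment> \<open>Since \<open>- n\<close> lies in the trace of \<open>X\<close>, it also lies in
    \<open>Y\<close>; thus the support of \<open>Y\<close> has an equation at \<open>n\<close> that
    the support of \<open>X\<close> lacks.\<close>
  obtain n where n: "n \<in> normals A" "n \<in> Y" "n \<notin> X" using XY by blast
  then have "- n \<in> X" "- n \<in> normals A" using Pos_sets_total[OF X, of n] minus_normals by auto
  then have nY: "n \<in> lineality Y" and nX: "n \<notin> lineality X"
    using n XY by (auto simp: lineality_def)
  \<comment> \<open>By purity no nonzero multiple of \<open>n\<close> lies in
    \<open>lineality X\<close>, so separation applies.\<close>
  obtain f :: "'a \<Rightarrow> real" where f: "Modules.additive f" "\<And>x. x \<in> lineality X \<Longrightarrow> f x = 0" "f n \<noteq> 0"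
    using additive_separation[OF L subspace_lineality[OF X], of n] lineality_pure[OF X] nX by metis
  obtain \<phi> :: "'a realification dual" where \<phi>: "\<And>l. dual_apply \<phi> (1 \<otimes>\<^sub>\<real> l) = f l"
    using dual_extension[OF f(1)] by blast
  have "\<phi> \<in> ?V X" "\<phi> \<notin> ?V Y" using f nY n(1) \<phi> by auto
  \<comment> \<open>Such an element and its negative are both in the trace of \<open>X\<close>,
    hence in \<open>Y\<close>: every equation for \<open>X\<close> is one for
    \<open>Y\<close>.\<close>
  moreover have "normals A \<inter> lineality X \<subseteq> lineality Y"
    using XY minus_normals by (auto simp: lineality_def)
  then have "?V Y \<subseteq> ?V X" by auto
  ultimately have "?V Y \<subset> ?V X" by blast
  moreover obtain W :: "'a realification dual set" where "finite W" "span W = UNIV"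
    using dual_finite_dimensional[OF L] .
  ultimately have "dim (?V Y) < dim (?V X)"
    using dim_psubset_finite[of W "?V X" "?V Y"] sub by simp
  then show ?thesis
    by (simp add: facet_dim_def facet_support_preimage[OF A X] facet_support_preimage[OF A Y])
qed

theorem proposition3p4:
  fixes A :: "'a::ab_group_add set set set" and F :: "'a set set" and X :: "'a set"
  assumes "is_lattice TYPE('a)"
    and "finite A" and "A \<subseteq> rational_hyperplanes"
    and "F \<in> facets A" and "X \<in> F"
  shows "F = Pos_sets \<inter> (\<Inter>H\<in>A. side H X) \<and>
    Pos_topology closure_of F =
      Pos_sets \<inter> (\<Inter>H\<in>A. Pos_topology closure_of (side H X)) \<and>
    (\<exists>\<G> \<subseteq> facets A. (\<forall>G\<in>\<G>. facet_dim A G < facet_dim A F) \<and>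
      Pos_topology closure_of F = F \<union> \<Union>\<G>) \<and>
    (\<forall>F'\<in>facets A. Pos_topology closure_of F = Pos_topology closure_of F' \<longrightarrow> F = F')"
proof -
  note A = assms(3)
  let ?N = "normals A"
  have F: "F = trace_class ?N X" and X: "X \<in> Pos_sets"
    using assms(4,5) trace_class_eq unfolding facets_eq[OF A] by (auto simp: trace_class_def)
  have cl: "Pos_topology closure_of trace_class ?N Y = {Z \<in> Pos_sets. Y \<inter> ?N \<subseteq> Z}"
    if "Y \<in> Pos_sets" for Y
    using closure_of_trace_class[OF that, of ?N] minus_normals by blast
  have side: "side H X = trace_class (normals {H}) X" if "H \<in> A" for H
    using side_eq_trace_class[OF _ X] A that by blast
  have cl_side: "Pos_topology closure_of side H X = {Y \<in> Pos_sets. X \<inter> normals {H} \<subseteq> Y}"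
    if "H \<in> A" for H
    unfolding side[OF that] by (intro closure_of_trace_class[OF X] minus_normals)
  have N: "?N = (\<Union>H\<in>A. normals {H})" by (simp add: normals_def)
  \<comment> \<open>Equality of traces on a union of sets \<open>normals {H}\<close> splits into
    equality on each; for \<open>b\<close>, the inclusion \<open>X \<inter> ?N \<subseteq> Y\<close>
    splits likewise.\<close>
  have a: "F = Pos_sets \<inter> (\<Inter>H\<in>A. side H X)"
    unfolding F N by (simp add: side trace_class_def set_eq_iff) blast
  have b: "Pos_topology closure_of F = Pos_sets \<inter> (\<Inter>H\<in>A. Pos_topology closure_of (side H X))"
    unfolding F cl[OF X] unfolding N by (auto simp: cl_side)
  let ?G = "{trace_class ?N Y | Y. Y \<in> Pos_sets \<and> X \<inter> ?N \<subset> Y \<inter> ?N}"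
  have "?G \<subseteq> facets A" unfolding facets_eq[OF A] by blast
  moreover have "\<forall>G\<in>?G. facet_dim A G < facet_dim A F"
    using facet_dim_less[OF assms(1) A X] unfolding F by blast
  \<comment> \<open>A point of the closure has a trace containing that of \<open>X\<close>: equality
    puts it in \<open>F\<close>, proper inclusion in a member of \<open>?G\<close>.\<close>
  moreover have "Pos_topology closure_of F = F \<union> \<Union>?G"
    unfolding F cl[OF X] by (auto simp: trace_class_def)
  ultimately have c: "\<exists>\<G> \<subseteq> facets A. (\<forall>G\<in>\<G>. facet_dim A G < facet_dim A F) \<and>
      Pos_topology closure_of F = F \<union> \<Union>\<G>" by blast
  have d: "F = F'" if F': "F' \<in> facets A" "Pos_topology closure_of F = Pos_topology closure_of F'" for F'
  proof -
    obtain Y where Y: "Y \<in> Pos_sets" "F' = trace_class ?N Y"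
      using F'(1) unfolding facets_eq[OF A] by blast
    have "{Z \<in> Pos_sets. X \<inter> ?N \<subseteq> Z} = {Z \<in> Pos_sets. Y \<inter> ?N \<subseteq> Z}"
      using F'(2) cl[OF X] cl[OF Y(1)] by (simp add: F Y(2))
    \<comment> \<open>Each of \<open>X\<close> and \<open>Y\<close> belongs to the closure of its
      own facet, hence to that of the other.\<close>
    then have "X \<inter> ?N \<subseteq> Y" "Y \<inter> ?N \<subseteq> X" using X Y(1) by blast+
    then have "X \<inter> ?N = Y \<inter> ?N" by blast
    then show ?thesis by (simp add: F Y(2) trace_class_def)
  qed
  show ?thesis by (intro conjI a b c ballI impI) (rule d)
qed

end
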